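(* Let $n$ be an even positive integer, $k\ge 2$, and let $B_j\in\mathbb{R}^{[j,n]}$, $j=2,\dots,k$, be supersymmetric tensors. Consider the Hamiltonian system on $\mathbb{R}^n$ $$\dot{x}=kJB_kx^{k-1}+(k-1)JB_{k-1}x^{k-2}+\cdots+2JB_2x .$$ If the matrix $B_2$ is positive definite or negative definite, then the origin is a Lyapunov stable equilibrium of this system.
   Context: $\mathbb{R}^{[k,n]}$ denotes the set of real cubical tensors of order $k$ and dimension $n$, i.e. arrays $(A_{i_1\ldots i_k})$ with $1\le i_1,\dots,i_k\le n$. A tensor is supersymmetric if its entries are invariant under every permutation of the indices. For $A\in\mathbb{R}^{[k,n]}$ and $x\in\mathbb{R}^n$, $Ax^{k-1}\in\mathbb{R}^n$ is the vector with entries $(Ax^{k-1})_{i_1}=\sum_{i_2,\ldots,i_k=1}^n A_{i_1i_2\ldots i_k}x_{i_2}\cdots x_{i_k}$. For a matrix $R\in\mathbb{R}^{n\times n}$, the product $RA\in\mathbb{R}^{[k,n]}$ is $(RA)_{i_1i_2\ldots i_k}=\sum_{j=1}^nR_{i_1j}A_{ji_2\ldots i_k}$. For even $n=2m$, $J=\begin{pmatrix}0&I_m\\-I_m&0\end{pmatrix}\in\mathbb{R}^{n\times n}$. The system is $\dot x=J\,\partial H/\partial x$ with $H(x)=\sum_{j=2}^kB_jx^j$, where $B_jx^j=\sum_{i_1,\ldots,i_j=1}^n(B_j)_{i_1\ldots i_j}x_{i_1}\cdots x_{i_j}$. *)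

theory Defs
  imports "HOL-Analysis.Analysis" "HOL-Combinatorics.Permutations"
begin

text \<open>A tensor of order \<open>k\<close> and dimension \<open>CARD('n)\<close> is represented by its entries, indexed by the
  lists of length \<open>k\<close> over \<open>'n\<close>. The order is not part of the type: it is passed explicitly
  where it matters, and the values on lists of any other length are never used.\<close>

type_synonym 'n tensor = "'n list \<Rightarrow> real"

lemma finite_index_lists: "finite {is :: 'n::finite list. length is = k}"
  using finite_lists_length_eq[of "UNIV :: 'n set" k] by simp

definition supersymmetric :: "nat \<Rightarrow> 'n tensor \<Rightarrow> bool" where
  "supersymmetric k A \<longleftrightarrow>
     (\<forall>is p. length is = k \<longrightarrow> p permutes {..<k} \<longrightarrow> A (permute_list p is) = A is)"

text \<open>The vector \<open>A x\<^sup>k\<^sup>-\<^sup>1\<close> for \<open>A\<close> of order \<open>k\<close>.\<close>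

definition tensor_apply :: "nat \<Rightarrow> 'n tensor \<Rightarrow> real ^ 'n \<Rightarrow> real ^ 'n::finite" where
  "tensor_apply k A x =
     (\<chi> i. \<Sum>is | length is = k - 1. A (i # is) * (\<Prod>l\<leftarrow>is. x $ l))"

definition matrix_tensor_mult :: "real ^ 'n ^ 'n \<Rightarrow> 'n tensor \<Rightarrow> 'n::finite tensor" where
  "matrix_tensor_mult R A is =
     (case is of [] \<Rightarrow> 0 | i # js \<Rightarrow> \<Sum>j\<in>UNIV. R $ i $ j * A (j # js))"

definition tensor_matrix :: "'n tensor \<Rightarrow> real ^ 'n ^ 'n::finite" where
  "tensor_matrix A = (\<chi> i j. A [i, j])"

definition positive_definite :: "real ^ 'n ^ 'n::finite \<Rightarrow> bool" where
  "positive_definite M \<longleftrightarrow> (\<forall>x. x \<noteq> 0 \<longrightarrow> x \<bullet> (M *v x) > 0)"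

definition negative_definite :: "real ^ 'n ^ 'n::finite \<Rightarrow> bool" where
  "negative_definite M \<longleftrightarrow> (\<forall>x. x \<noteq> 0 \<longrightarrow> x \<bullet> (M *v x) < 0)"

definition block_matrix ::
  "real ^ 'm ^ 'm \<Rightarrow> real ^ 'm ^ 'm \<Rightarrow> real ^ 'm ^ 'm \<Rightarrow> real ^ 'm ^ 'm
     \<Rightarrow> real ^ ('m + 'm) ^ ('m::finite + 'm)" where
  "block_matrix P Q R S = (\<chi> i j.
     (case i of
        Inl a \<Rightarrow> (case j of Inl b \<Rightarrow> P $ a $ b | Inr b \<Rightarrow> Q $ a $ b)
      | Inr a \<Rightarrow> (case j of Inl b \<Rightarrow> R $ a $ b | Inr b \<Rightarrow> S $ a $ b)))"

text \<open>Coordinates of a space of even dimension \<open>n = 2 m\<close> are indexed by \<open>'m + 'm\<close> with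
  \<open>CARD('m) = m\<close>; \<open>Inl\<close> and \<open>Inr\<close> give the first and the last \<open>m\<close> coordinates.\<close>

definition symplectic_J :: "real ^ ('m + 'm) ^ ('m::finite + 'm)" where
  "symplectic_J = block_matrix 0 (mat 1) (- mat 1) 0"

definition hamiltonian_field ::
  "nat \<Rightarrow> (nat \<Rightarrow> ('m + 'm) tensor) \<Rightarrow> real ^ ('m + 'm) \<Rightarrow> real ^ ('m::finite + 'm)" where
  "hamiltonian_field k B x =
     (\<Sum>j = 2..k. real j *\<^sub>R tensor_apply j (matrix_tensor_mult symplectic_J (B j)) x)"

definition solution_on ::
  "real set \<Rightarrow> ('a \<Rightarrow> 'a) \<Rightarrow> (real \<Rightarrow> 'a::real_normed_vector) \<Rightarrow> bool" where
  "solution_on I f x \<longleftrightarrow> (\<forall>t\<in>I. (x has_vector_derivative f (x t)) (at t within I))"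

definition equilibrium :: "('a \<Rightarrow> 'a) \<Rightarrow> 'a::real_normed_vector \<Rightarrow> bool" where
  "equilibrium f e \<longleftrightarrow> f e = 0"

text \<open>Since solutions of \<open>x' = f x\<close> may a priori blow up in finite time, stability includes that a
  solution for all times \<open>t \<ge> 0\<close> exists for each initial value close to \<open>e\<close>. The bound is
  required of every solution, including those defined only on an interval \<open>{0..T}\<close>.\<close>

definition lyapunov_stable :: "('a \<Rightarrow> 'a) \<Rightarrow> 'a::real_normed_vector \<Rightarrow> bool" where
  "lyapunov_stable f e \<longleftrightarrow>
     (\<forall>\<epsilon>>0. \<exists>\<delta>>0. \<forall>x0. dist x0 e < \<delta> \<longrightarrow>
        (\<exists>x. x 0 = x0 \<and> solution_on {0..} f x) \<and>
        (\<forall>T x. x 0 = x0 \<longrightarrow> solution_on {0..T} f x \<longrightarrow> (\<forall>t\<in>{0..T}. dist (x t) e < \<epsilon>)))"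

end

theory Submission
  imports Defs
begin

text \<open>The field is \<open>J \<nabla>H\<close>, because supersymmetry gives \<open>\<nabla>(B\<^sub>j x\<^sup>j) = j B\<^sub>j x\<^sup>j\<^sup>-\<^sup>1\<close>; since \<open>J\<close> is
  skew-symmetric, \<open>H\<close> is conserved. The quadratic part of \<open>H\<close> is definite and the remainder is
  \<open>O(|x|\<^sup>3)\<close>, so \<open>H\<close> or \<open>-H\<close> has a strict local minimum at the origin. A path starting at a value
  below the minimum over a small sphere can therefore never cross this sphere. For global existence
  the field is truncated outside the ball by the projection onto it, which makes it bounded
  and Lipschitz; a solution of the truncated system is trapped in the ball, where both fields agree.\<close>

section \<open>Global solutions of bounded Lipschitz fields\<close>

text \<open>With \<open>x t = exp (2 K t) u t\<close>, the Picard operator acts on bounded continuous functions \<open>u\<close>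
  on the whole time axis, and the weight makes it a contraction with constant \<open>1/2\<close>.\<close>

lemma exists_global_solution:
  fixes g :: "'a::euclidean_space \<Rightarrow> 'a"
  assumes lip: "L-lipschitz_on UNIV g" and bnd: "\<And>y. norm (g y) \<le> M"
  shows "\<exists>x. x 0 = x0 \<and> solution_on {0..} g x"
proof -
  \<comment> \<open>The added 1 keeps \<open>K\<close> positive when \<open>L = 0\<close>; the
    bounds below divide by \<open>2 * K\<close>.\<close>
  define K where "K = L + 1"
  have K: "K > 0" using lipschitz_on_nonneg[OF lip] by (simp add: K_def)
  have gK: "norm (g y - g z) \<le> K * norm (y - z)" for y z
  proof -
    have "norm (g y - g z) \<le> L * norm (y - z)"
      using lipschitz_onD[OF lip, of y z] by (simp add: dist_norm)
    also have "\<dots> \<le> K * norm (y - z)" by (simp add: K_def mult_right_mono)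
    finally show ?thesis .
  qed
  have M: "M \<ge> 0" using bnd[of 0] norm_ge_zero order_trans by blast
  have contg: "continuous_on UNIV g" by (rule lipschitz_on_continuous_on[OF lip])
  define h where "h u \<tau> = g (exp (2 * K * \<tau>) *\<^sub>R apply_bcontfun u \<tau>)" for u :: "real \<Rightarrow>\<^sub>C 'a" and \<tau>
  have conth: "continuous_on S (h u)" for S u
    unfolding h_def by (rule continuous_on_compose2[OF contg]) (auto intro!: continuous_intros)
  have inth: "h u integrable_on {0..s}" for u s
    by (rule integrable_continuous_real[OF conth])
  \<comment> \<open>This is the Picard operator in the weighted variable. Elements of the function
    space live on the whole axis, so \<open>max 0 t\<close> freezes the value at time 0 for negative
    \<open>t\<close>.\<close>
  define \<Phi> where "\<Phi> u t = exp (- (2 * K * max 0 t)) *\<^sub>R (x0 + integral {0..max 0 t} (h u))" for u t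
  have contPhi: "continuous_on UNIV (\<Phi> u)" for u
  proof -
    have "continuous_on {0..} (\<lambda>s. integral {0..s} (h u))"
      unfolding continuous_on_eq_continuous_within
    proof
      fix t :: real assume t: "t \<in> {0..}"
      \<comment> \<open>Continuity is local: \<open>{0..t+1}\<close> is a neighbourhood of
        \<open>t\<close> relative to \<open>{0..}\<close>, even when \<open>t = 0\<close>, so the
        two filters agree. The same device returns for the derivative.\<close>
      have "continuous_on {0..t+1} (\<lambda>s. integral {0..s} (h u))"
        by (rule indefinite_integral_continuous_1[OF inth])
      then have "continuous (at t within {0..t+1}) (\<lambda>s. integral {0..s} (h u))"
        using t by (simp add: continuous_on_eq_continuous_within)
      moreover have "at t within {0..t+1} = at t within {0..}"
        by (rule at_within_nhd[of _ "{..<t+1}"]) (use t in auto)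
      ultimately show "continuous (at t within {0..}) (\<lambda>s. integral {0..s} (h u))"
        by simp
    qed
    then have "continuous_on UNIV (\<lambda>t. integral {0..max 0 t} (h u))"
      by (rule continuous_on_compose2) (auto intro!: continuous_intros)
    then show ?thesis unfolding \<Phi>_def by (intro continuous_intros)
  qed
  have bndPhi: "norm (\<Phi> u t) \<le> norm x0 + M / (2 * K)" for u t
  proof -
    define s where "s = max 0 t"
    have s: "s \<ge> 0" by (simp add: s_def)
    have "norm (integral {0..s} (h u)) \<le> integral {0..s} (\<lambda>_. M)"
      by (rule integral_norm_bound_integral[OF inth]) (auto simp: h_def bnd)
    also have "\<dots> = M * s" using s by simp
    finally have "norm (x0 + integral {0..s} (h u)) \<le> norm x0 + M * s"
      using norm_triangle_ineq[of x0 "integral {0..s} (h u)"] by linarith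
    then have "norm (\<Phi> u t) \<le> exp (- (2 * K * s)) * (norm x0 + M * s)"
      unfolding \<Phi>_def s_def[symmetric] by (simp add: mult_left_mono)
    also have "\<dots> = exp (- (2 * K * s)) * norm x0 + M * (s * exp (- (2 * K * s)))"
      by (simp add: algebra_simps)
    also have "\<dots> \<le> 1 * norm x0 + M * (1 / (2 * K))"
    proof (intro add_mono mult_right_mono mult_left_mono M)
      show "exp (- (2 * K * s)) \<le> 1" using K s by simp
      \<comment> \<open>The integral of a bounded field grows at most linearly in \<open>s\<close>,
        and the weight absorbs this growth.\<close>
      have "2 * K * s \<le> exp (2 * K * s)"
        using exp_ge_add_one_self[of "2 * K * s"] by linarith
      then show "s * exp (- (2 * K * s)) \<le> 1 / (2 * K)"
        using K by (simp add: exp_minus field_simps)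
    qed auto
    finally show ?thesis by simp
  qed
  have Phi_bcf: "\<Phi> u \<in> bcontfun" for u
    by (rule bcontfun_normI[OF contPhi bndPhi])
  define \<Psi> where "\<Psi> u = Bcontfun (\<Phi> u)" for u
  have Psi: "apply_bcontfun (\<Psi> u) = \<Phi> u" for u
    unfolding \<Psi>_def by (rule Bcontfun_inverse[OF Phi_bcf])
  have contraction: "dist (\<Psi> u) (\<Psi> v) \<le> 1/2 * dist u v" for u v
  proof (rule dist_bound)
    fix t :: real
    define s where "s = max 0 t"
    have s: "s \<ge> 0" by (simp add: s_def)
    define d where "d = dist u v"
    \<comment> \<open>The 2 in the exponent pays off here: integrating
      \<open>K * exp (2 * K * \<tau>)\<close> yields half the weight at \<open>s\<close>, whence the
      factor \<open>1/2\<close>.\<close>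
    have I: "((\<lambda>\<tau>. K * exp (2 * K * \<tau>) * d) has_integral
        (exp (2 * K * s) * d / 2 - exp (2 * K * 0) * d / 2)) {0..s}"
      by (rule fundamental_theorem_of_calculus[OF s])
        (auto intro!: derivative_eq_intros simp flip: has_real_derivative_iff_has_vector_derivative)
    have le: "norm (h u \<tau> - h v \<tau>) \<le> K * exp (2 * K * \<tau>) * d" for \<tau>
    proof -
      have "norm (h u \<tau> - h v \<tau>) \<le>
          K * norm (exp (2 * K * \<tau>) *\<^sub>R apply_bcontfun u \<tau> - exp (2 * K * \<tau>) *\<^sub>R apply_bcontfun v \<tau>)"
        unfolding h_def by (rule gK)
      also have "\<dots> = K * exp (2 * K * \<tau>) * dist (apply_bcontfun u \<tau>) (apply_bcontfun v \<tau>)"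
        by (simp add: dist_norm flip: scaleR_right_diff_distrib)
      also have "\<dots> \<le> K * exp (2 * K * \<tau>) * d"
        unfolding d_def using K by (intro mult_left_mono dist_bounded) auto
      finally show ?thesis .
    qed
    have "norm (integral {0..s} (\<lambda>\<tau>. h u \<tau> - h v \<tau>)) \<le> integral {0..s} (\<lambda>\<tau>. K * exp (2 * K * \<tau>) * d)"
      by (rule integral_norm_bound_integral[OF integrable_diff[OF inth inth]])
        (use I le in \<open>auto simp: has_integral_integrable\<close>)
    also have "\<dots> \<le> exp (2 * K * s) * d / 2"
      using integral_unique[OF I] by (simp add: d_def)
    finally have "norm (integral {0..s} (h u) - integral {0..s} (h v)) \<le> exp (2 * K * s) * d / 2"
      by (simp add: integral_diff[OF inth inth])
    then have "exp (- (2 * K * s)) * norm (integral {0..s} (h u) - integral {0..s} (h v))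
        \<le> exp (- (2 * K * s)) * (exp (2 * K * s) * d / 2)"
      by (intro mult_left_mono) auto
    also have "\<dots> = 1/2 * d" by (simp add: exp_minus)
    finally show "dist (apply_bcontfun (\<Psi> u) t) (apply_bcontfun (\<Psi> v) t) \<le> 1/2 * dist u v"
      unfolding Psi \<Phi>_def s_def[symmetric] d_def
      by (simp add: dist_norm flip: scaleR_right_diff_distrib)
  qed
  obtain u where u: "\<Psi> u = u"
    using banach_fix_type[of "1/2" \<Psi>] contraction by auto
  \<comment> \<open>Multiplying by \<open>exp (2 * K * t)\<close> undoes the weight; the fixed point
    equation becomes the integral equation for \<open>t \<ge> 0\<close>.\<close>
  define x where "x t = exp (2 * K * t) *\<^sub>R apply_bcontfun u t" for t
  have x: "x t = x0 + integral {0..t} (\<lambda>\<tau>. g (x \<tau>))" if "t \<ge> 0" for t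
  proof -
    have "apply_bcontfun u t = \<Phi> u t" using Psi[of u] u by simp
    also have "\<dots> = exp (- (2 * K * t)) *\<^sub>R (x0 + integral {0..t} (h u))"
      using that by (simp add: \<Phi>_def)
    finally show ?thesis
      unfolding x_def by (simp add: h_def[abs_def] flip: exp_add)
  qed
  have "(x has_vector_derivative g (x t)) (at t within {0..})" if t: "t \<in> {0..}" for t
  proof -
    have "continuous_on {0..t+1} (\<lambda>\<tau>. g (x \<tau>))"
      using conth[of "{0..t+1}" u] by (simp add: h_def[abs_def] x_def)
    then have "((\<lambda>s. integral {0..s} (\<lambda>\<tau>. g (x \<tau>))) has_vector_derivative g (x t)) (at t within {0..t+1})"
      by (rule integral_has_vector_derivative) (use t in auto)
    moreover have "at t within {0..t+1} = at t within {0..}"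
      by (rule at_within_nhd[of _ "{..<t+1}"]) (use t in auto)
    ultimately have "((\<lambda>s. x0 + integral {0..s} (\<lambda>\<tau>. g (x \<tau>))) has_vector_derivative g (x t)) (at t within {0..})"
      by (auto intro!: derivative_eq_intros)
    then show ?thesis
      by (rule has_vector_derivative_transform[rotated 2]) (use t x in auto)
  qed
  moreover have "x 0 = x0" using x[of 0] by simp
  ultimately show ?thesis by (auto simp: solution_on_def)
qed

section \<open>Stability from a conserved quantity\<close>

text \<open>By the chain rule the derivative of \<open>V\<close> along the path is a multiple of
  \<open>V' (x s) (f (x s)) = 0\<close>. Derivatives within \<open>{0..T}\<close> suffice, since the
  interval is convex.\<close>

lemma conserved_quantity_constant:
  fixes V :: "'a::real_normed_vector \<Rightarrow> real"
  assumes deriv: "\<And>y. (V has_derivative V' y) (at y)"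
    and conserved: "\<And>y. V' y (f y) = 0"
    and sol: "solution_on {0..T} f x" and t: "t \<in> {0..T}"
  shows "V (x t) = V (x 0)"
proof -
  have "((\<lambda>s. V (x s)) has_derivative (\<lambda>_. 0)) (at s within {0..T})" if "s \<in> {0..T}" for s
  proof -
    have "(x has_derivative (\<lambda>h. h *\<^sub>R f (x s))) (at s within {0..T})"
      using sol that by (simp add: solution_on_def has_vector_derivative_def)
    from has_derivative_compose[OF this deriv]
    have "((\<lambda>s. V (x s)) has_derivative (\<lambda>h. V' (x s) (h *\<^sub>R f (x s)))) (at s within {0..T})" .
    moreover have "V' (x s) (h *\<^sub>R f (x s)) = 0" for h
      using has_derivative_linear[OF deriv[of "x s"]] conserved[of "x s"]
      by (simp add: linear_cmul)
    ultimately show ?thesis by simp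
  qed
  then obtain c where "\<forall>s\<in>{0..T}. V (x s) = c"
    using has_derivative_zero_constant[of "{0..T}" "\<lambda>s. V (x s)"] by auto
  then show ?thesis using t by auto
qed

lemma solution_on_imp_continuous_on: "solution_on I f x \<Longrightarrow> continuous_on I x"
  unfolding solution_on_def
  by (meson continuous_on_eq_continuous_within has_vector_derivative_continuous)

lemma solution_on_subset: "solution_on I f x \<Longrightarrow> J \<subseteq> I \<Longrightarrow> solution_on J f x"
  unfolding solution_on_def by (meson has_vector_derivative_within_subset subsetD)

text \<open>The field \<open>f\<close> is only followed as long as the path stays in the ball, so that the lemma
  also applies to solutions of a truncated field.\<close>

lemma trapped_in_ball:
  fixes V :: "'a::real_normed_vector \<Rightarrow> real"
  assumes deriv: "\<And>y. (V has_derivative V' y) (at y)"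
    and conserved: "\<And>y. V' y (f y) = 0"
    and sphere: "\<And>y. norm y = r \<Longrightarrow> V (x 0) < V y"
    and start: "norm (x 0) < r"
    and cont: "continuous_on {0..T} x"
    and sol: "\<And>s. s \<le> T \<Longrightarrow> (\<And>\<tau>. \<tau> \<in> {0..s} \<Longrightarrow> norm (x \<tau>) \<le> r) \<Longrightarrow> solution_on {0..s} f x"
    and t: "t \<in> {0..T}"
  shows "norm (x t) < r"
proof (rule ccontr)
  assume "\<not> norm (x t) < r"
  \<comment> \<open>\<open>A\<close> collects the times outside the open ball. It is compact and
    nonempty, so there is a first exit time \<open>s\<close>.\<close>
  define A where "A = {s \<in> {0..T}. r \<le> norm (x s)}"
  have "continuous_on {0..T} (\<lambda>s. norm (x s))" using cont by (intro continuous_intros)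
  then have "closed A"
    unfolding A_def by (intro closed_Collect_le continuous_on_closed_Collect_le) auto
  moreover have "bounded A" by (rule bounded_subset[of "{0..T}"]) (auto simp: A_def)
  moreover have "A \<noteq> {}" using t \<open>\<not> norm (x t) < r\<close> by (auto simp: A_def)
  ultimately obtain s where s: "s \<in> A" and first: "\<And>\<tau>. \<tau> \<in> A \<Longrightarrow> s \<le> \<tau>"
    using compact_attains_inf[of A] compact_eq_bounded_closed by blast
  have sT: "0 \<le> s" "s \<le> T" "r \<le> norm (x s)" using s by (auto simp: A_def)
  have "continuous_on {0..s} (\<lambda>s. norm (x s))"
    using sT by (intro continuous_intros continuous_on_subset[OF cont]) auto
  \<comment> \<open>The intermediate value theorem gives a time up to \<open>s\<close> at radius
    exactly \<open>r\<close>. It lies in \<open>A\<close>, so it equals \<open>s\<close>: the path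
    exits through the sphere itself.\<close>
  then obtain \<tau> where \<tau>: "0 \<le> \<tau>" "\<tau> \<le> s" "norm (x \<tau>) = r"
    using IVT'[of "\<lambda>s. norm (x s)" 0 r s] start sT by auto
  have "\<tau> \<in> A" using \<tau> sT by (auto simp: A_def)
  with \<tau> first have eq: "norm (x s) = r" by force
  have "norm (x \<tau>) \<le> r" if "\<tau> \<in> {0..s}" for \<tau>
  proof (cases "\<tau> = s")
    case False
    then have "\<tau> \<notin> A" using first[of \<tau>] that by auto
    then show ?thesis using that sT by (auto simp: A_def)
  qed (simp add: eq)
  then have "solution_on {0..s} f x" using sol sT by blast
  then have "V (x s) = V (x 0)"
    using conserved_quantity_constant[OF deriv conserved, of s x s] sT by simp
  with sphere[OF eq] show False by simp
qed

text \<open>The minimum \<open>V z\<close> over a small sphere is a barrier above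
  \<open>V 0\<close>; starting points with values below it stay enclosed. The Lipschitz constant may
  depend on the ball, as it does for polynomial fields, so global existence has to come from
  truncation and trapping.\<close>

lemma lyapunov_stable_if_conserved_strict_min:
  fixes f :: "'a::euclidean_space \<Rightarrow> 'a" and V :: "'a \<Rightarrow> real"
  assumes deriv: "\<And>y. (V has_derivative V' y) (at y)"
    and conserved: "\<And>y. V' y (f y) = 0"
    and \<rho>: "\<rho> > 0" and min: "\<And>y. y \<noteq> 0 \<Longrightarrow> norm y \<le> \<rho> \<Longrightarrow> V 0 < V y"
    and lip: "\<And>r. \<exists>L. L-lipschitz_on (cball 0 r) f"
  shows "lyapunov_stable f 0"
  unfolding lyapunov_stable_def
proof (intro allI impI)
  fix \<epsilon> :: real assume \<epsilon>: "\<epsilon> > 0"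
  define r where "r = min \<epsilon> \<rho>"
  have r: "r > 0" "r \<le> \<epsilon>" "r \<le> \<rho>" using \<epsilon> \<rho> by (auto simp: r_def)
  have contV: "continuous_on S V" for S
    using deriv by (meson continuous_at_imp_continuous_on has_derivative_continuous)
  have "compact (sphere (0::'a) r)" "sphere (0::'a) r \<noteq> {}" using r by auto
  from continuous_attains_inf[OF this contV] obtain z
    where z: "z \<in> sphere 0 r" and zmin: "\<And>y. y \<in> sphere 0 r \<Longrightarrow> V z \<le> V y" by blast
  have "V 0 < V z" using z r by (intro min) auto
  moreover have "isCont V 0" using deriv has_derivative_continuous by blast
  ultimately have "eventually (\<lambda>y. V y < V z) (nhds 0)"
    using order_tendstoD(2)[of V "V 0" "nhds 0" "V z"] by (simp add: continuous_at tendsto_nhds_iff)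
  then obtain \<delta>' where \<delta>': "\<delta>' > 0" "\<And>y. dist y 0 < \<delta>' \<Longrightarrow> V y < V z"
    unfolding eventually_nhds_metric by blast
  \<comment> \<open>A starting point must have a value below the barrier and also lie inside the
    sphere.\<close>
  define \<delta> where "\<delta> = min \<delta>' r"
  have \<delta>: "\<delta> > 0" "\<delta> \<le> r" using \<delta>' r by (auto simp: \<delta>_def)
  have sph: "V x0 < V y" if "dist x0 0 < \<delta>" "norm y = r" for x0 y
    using that \<delta>'(2)[of x0] zmin[of y] by (auto simp: \<delta>_def)
  obtain L where L: "L-lipschitz_on (cball 0 r) f" using lip by blast
  define P where "P = closest_point (cball (0::'a) r)"
  define g where "g y = f (P y)" for y
  have P: "P y \<in> cball 0 r" for y unfolding P_def using r by (intro closest_point_in_set) auto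
  \<comment> \<open>Projection onto a closed convex set does not increase distances, so
    \<open>g\<close> inherits the constant of \<open>f\<close> on the ball, and its values lie in a
    compact image.\<close>
  have "1-lipschitz_on UNIV P"
    unfolding P_def using r by (intro lipschitz_onI) (auto intro!: closest_point_lipschitz)
  then have "(L * 1)-lipschitz_on UNIV g"
    unfolding g_def using L P by (intro lipschitz_on_compose2) (auto intro: lipschitz_on_subset)
  moreover obtain M where "\<And>y. norm (g y) \<le> M"
  proof -
    have "compact (f ` cball 0 r)"
      by (intro compact_continuous_image lipschitz_on_continuous_on[OF L]) auto
    then obtain M where "\<And>y. y \<in> cball 0 r \<Longrightarrow> norm (f y) \<le> M"
      using compact_imp_bounded bounded_iff by (metis imageI)
    then show thesis using P by (intro that[of M]) (simp add: g_def)
  qed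
  ultimately have ex: "\<exists>x. x 0 = x0 \<and> solution_on {0..} g x" for x0
    by (rule exists_global_solution)
  have gf: "g y = f y" if "norm y \<le> r" for y
    unfolding g_def P_def using that by (simp add: closest_point_self)
  have "(\<exists>x. x 0 = x0 \<and> solution_on {0..} f x) \<and>
     (\<forall>T x. x 0 = x0 \<longrightarrow> solution_on {0..T} f x \<longrightarrow> (\<forall>t\<in>{0..T}. dist (x t) 0 < \<epsilon>))"
    if x0: "dist x0 0 < \<delta>" for x0
  proof (intro conjI allI impI ballI)
    obtain x where x: "x 0 = x0" "solution_on {0..} g x" using ex by blast
    have "norm (x t) < r" if "t \<in> {0..}" for t
    proof (rule trapped_in_ball[OF deriv conserved])
      show "continuous_on {0..t} x"
        using solution_on_imp_continuous_on[OF x(2)] by (rule continuous_on_subset) auto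
      \<comment> \<open>While the path is in the closed ball, \<open>g\<close> and \<open>f\<close>
        agree along it; this is the conditional hypothesis that \<open>trapped_in_ball\<close> asks
        for.\<close>
      show "solution_on {0..s} f x" if "\<And>\<tau>. \<tau> \<in> {0..s} \<Longrightarrow> norm (x \<tau>) \<le> r" for s
        using solution_on_subset[OF x(2), of "{0..s}"] that gf by (auto simp: solution_on_def)
    qed (use x x0 sph \<delta> that in auto)
    then have "solution_on {0..} f x"
      using x(2) gf by (auto simp: solution_on_def less_imp_le)
    with x(1) show "\<exists>x. x 0 = x0 \<and> solution_on {0..} f x" by blast
  next
    fix T x t assume x: "x 0 = x0" "solution_on {0..T} f x" "t \<in> {0..T}"
    have "norm (x t) < r"
    proof (rule trapped_in_ball[OF deriv conserved _ _ _ _ x(3)])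
      show "continuous_on {0..T} x" using solution_on_imp_continuous_on[OF x(2)] .
      show "solution_on {0..s} f x" if "s \<le> T" for s
        by (rule solution_on_subset[OF x(2)]) (use that in auto)
    qed (use x x0 sph \<delta> in auto)
    then show "dist (x t) 0 < \<epsilon>" using r by simp
  qed
  with \<delta> show "\<exists>\<delta>>0. \<forall>x0. dist x0 0 < \<delta> \<longrightarrow> (\<exists>x. x 0 = x0 \<and> solution_on {0..} f x) \<and>
     (\<forall>T x. x 0 = x0 \<longrightarrow> solution_on {0..T} f x \<longrightarrow> (\<forall>t\<in>{0..T}. dist (x t) 0 < \<epsilon>))"
    by blast
qed

section \<open>Forms associated with tensors\<close>

definition tensor_form :: "nat \<Rightarrow> 'n tensor \<Rightarrow> real ^ 'n::finite \<Rightarrow> real" where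
  "tensor_form j A x = (\<Sum>is | length is = j. A is * (\<Prod>l\<leftarrow>is. x $ l))"

lemma sum_lists_length_Suc:
  fixes F :: "'n::finite list \<Rightarrow> 'b::comm_monoid_add"
  shows "(\<Sum>is | length is = Suc n. F is) = (\<Sum>i\<in>UNIV. \<Sum>js | length js = n. F (i # js))"
proof -
  have "(\<Sum>is | length is = Suc n. F is) = (\<Sum>(i, js)\<in>UNIV \<times> {js. length js = n}. F (i # js))"
    by (rule sum.reindex_bij_witness[of _ "\<lambda>(i, js). i # js" "\<lambda>is. (hd is, tl is)"])
      (auto simp: length_Suc_conv)
  then show ?thesis by (simp add: sum.cartesian_product)
qed

text \<open>Pairing with \<open>v\<close> fills the first slot of \<open>A\<close>. Summing over
  full index lists puts all slots on an equal footing, so that they can be permuted.\<close>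

lemma inner_tensor_apply:
  assumes "j \<ge> 1"
  shows "v \<bullet> tensor_apply j A x =
    (\<Sum>is | length is = j. A is * (v $ hd is * (\<Prod>l\<leftarrow>tl is. x $ l)))"
proof -
  obtain n where "j = Suc n" using assms by (cases j) auto
  then show ?thesis
    by (simp add: sum_lists_length_Suc tensor_apply_def inner_vec_def sum_distrib_left mult_ac)
qed

lemma tensor_form_eq_inner: "j \<ge> 1 \<Longrightarrow> tensor_form j A x = x \<bullet> tensor_apply j A x"
  unfolding inner_tensor_apply tensor_form_def
  by (intro sum.cong refl) (auto simp: Suc_le_eq neq_Nil_conv)

text \<open>This is the product rule by positions in the list rather than by coordinates, because an
  index may occur several times.\<close>

lemma has_derivative_prod_list_nth:
  fixes x :: "real ^ 'n::finite"
  shows "((\<lambda>x. \<Prod>l\<leftarrow>is. x $ l) has_derivative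
    (\<lambda>v. \<Sum>a<length is. v $ (is ! a) * (\<Prod>b\<in>{..<length is} - {a}. x $ (is ! b)))) (at x)"
proof -
  have "(\<lambda>x :: real ^ 'n. \<Prod>l\<leftarrow>is. x $ l) = (\<lambda>x. \<Prod>a<length is. x $ (is ! a))"
    by (simp add: prod.list_conv_set_nth atLeast0LessThan)
  then show ?thesis
    by (auto intro!: has_derivative_prod bounded_linear_imp_has_derivative bounded_linear_vec_nth)
qed

text \<open>By supersymmetry, differentiating any of the \<open>j\<close> factors has the same effect as
  differentiating the first one.\<close>

lemma tensor_form_has_derivative:
  fixes x :: "real ^ 'n::finite"
  assumes sym: "supersymmetric j A" and j: "j \<ge> 1"
  shows "(tensor_form j A has_derivative (\<lambda>v. real j * (v \<bullet> tensor_apply j A x))) (at x)"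
proof -
  let ?L = "{is :: 'n list. length is = j}"
  \<comment> \<open>\<open>D v a\<close> is the contribution from differentiating the factor in
    position \<open>a\<close>.\<close>
  define D where "D v a = (\<Sum>is\<in>?L. A is * (v $ (is ! a) * (\<Prod>b\<in>{..<j} - {a}. x $ (is ! b))))"
    for v :: "real ^ 'n" and a
  have "((\<lambda>x. \<Sum>is\<in>?L. A is * (\<Prod>l\<leftarrow>is. x $ l)) has_derivative
      (\<lambda>v. \<Sum>is\<in>?L. A is * (\<Sum>a<length is. v $ (is ! a) * (\<Prod>b\<in>{..<length is} - {a}. x $ (is ! b))))) (at x)"
    by (intro has_derivative_sum has_derivative_mult_right has_derivative_prod_list_nth)
  also have "(\<lambda>v. \<Sum>is\<in>?L. A is * (\<Sum>a<length is. v $ (is ! a) * (\<Prod>b\<in>{..<length is} - {a}. x $ (is ! b)))) =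
      (\<lambda>v. \<Sum>a<j. D v a)"
    unfolding D_def by (subst sum.swap) (simp add: sum_distrib_left)
  also have "\<dots> = (\<lambda>v. real j * (v \<bullet> tensor_apply j A x))"
  proof
    fix v
    have D0: "D v a = D v 0" if a: "a < j" for a
    proof -
      \<comment> \<open>The transposition moves position \<open>a\<close> to the front. It is an
        involution, so \<open>permute_list p\<close> is its own inverse on lists of length
        \<open>j\<close> and reindexes the sum in both directions.\<close>
      define p where "p = Transposition.transpose 0 a"
      have p: "p permutes {..<j}"
        unfolding p_def using a by (intro permutes_swap_id) auto
      have pp: "p (p b) = b" for b by (simp add: p_def)
      have pj: "p b < j \<longleftrightarrow> b < j" for b using permutes_in_image[OF p, of b] by simp
      have p0: "p b = a \<longleftrightarrow> b = 0" and pa: "p b = 0 \<longleftrightarrow> b = a" for b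
        by (auto simp: p_def Transposition.transpose_def)
      have perm2: "permute_list p (permute_list p is) = is" if "length is = j" for "is" :: "'n list"
        using that p by (intro nth_equalityI) (auto simp: permute_list_nth pp pj)
      have prd: "(\<Prod>b\<in>{..<j} - {0}. x $ (is ! p b)) = (\<Prod>b\<in>{..<j} - {a}. x $ (is ! b))" for "is"
        by (rule prod.reindex_bij_witness[of _ p p]) (auto simp: pp pj p0 pa)
      show ?thesis unfolding D_def
      proof (rule sum.reindex_bij_witness[of _ "permute_list p" "permute_list p"])
        fix "is" assume "is \<in> ?L"
        then have len: "length is = j" by simp
        have sym_is: "A (permute_list p is) = A is"
          using sym len p by (auto simp: supersymmetric_def)
        have nth: "permute_list p is ! b = is ! p b" if "b < j" for b
          using that len p by (simp add: permute_list_nth)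
        have "(\<Prod>b\<in>{..<j} - {0}. x $ (permute_list p is ! b)) = (\<Prod>b\<in>{..<j} - {0}. x $ (is ! p b))"
          by (rule prod.cong) (simp_all add: nth)
        moreover have "permute_list p is ! 0 = is ! a"
          using nth[of 0] a by (simp add: p_def)
        ultimately show "A (permute_list p is) * (v $ (permute_list p is ! 0) *
            (\<Prod>b\<in>{..<j} - {0}. x $ (permute_list p is ! b))) =
          A is * (v $ (is ! a) * (\<Prod>b\<in>{..<j} - {a}. x $ (is ! b)))"
          by (simp only: sym_is prd)
      qed (auto simp: perm2)
    qed
    have "(\<Sum>a<j. D v a) = (\<Sum>a<j. D v 0)" by (rule sum.cong[OF refl D0]) simp
    also have "\<dots> = real j * D v 0" by simp
    also have "D v 0 = v \<bullet> tensor_apply j A x"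
      unfolding D_def inner_tensor_apply[OF j]
    proof (rule sum.cong[OF refl])
      fix "is" assume "is \<in> ?L"
      then obtain i js where is_eq: "is = i # js" "j = Suc (length js)" using j by (cases "is") auto
      \<comment> \<open>Positions 1 to \<open>j - 1\<close> of the list are positions 0 to
        \<open>j - 2\<close> of its tail.\<close>
      have "(\<Prod>b\<in>{..<j} - {0}. x $ (is ! b)) = (\<Prod>b<length js. x $ (js ! b))"
        by (rule prod.reindex_bij_witness[of _ Suc "\<lambda>b. b - 1"]) (auto simp: is_eq)
      also have "\<dots> = (\<Prod>l\<leftarrow>tl is. x $ l)"
        by (simp add: is_eq prod.list_conv_set_nth atLeast0LessThan)
      finally show "A is * (v $ (is ! 0) * (\<Prod>b\<in>{..<j} - {0}. x $ (is ! b))) =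
          A is * (v $ hd is * (\<Prod>l\<leftarrow>tl is. x $ l))"
        by (simp add: is_eq)
    qed
    finally show "(\<Sum>a<j. D v a) = real j * (v \<bullet> tensor_apply j A x)" .
  qed
  finally show ?thesis unfolding tensor_form_def[abs_def] .
qed

section \<open>The symplectic matrix and the shape of the field\<close>

lemma tensor_apply_matrix_tensor_mult:
  "tensor_apply j (matrix_tensor_mult R A) x = R *v tensor_apply j A x"
  unfolding vec_eq_iff tensor_apply_def matrix_tensor_mult_def matrix_vector_mult_def
  by (auto simp: sum_distrib_left sum_distrib_right mult.assoc intro: sum.swap)

text \<open>For \<open>y = (q, p)\<close> the image under J is \<open>(p, -q)\<close>, and the two
  halves of the inner product cancel. This is what makes the Hamiltonian conserved.\<close>

lemma inner_symplectic_J_self: "y \<bullet> (symplectic_J *v y) = 0"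
proof -
  have UN: "(UNIV :: ('a + 'a) set) = Inl ` UNIV \<union> Inr ` UNIV"
    by (auto simp: UNIV_sum)
  have split: "(\<Sum>i\<in>UNIV. F i) = (\<Sum>a\<in>UNIV. F (Inl a)) + (\<Sum>a\<in>UNIV. F (Inr a))"
    for F :: "'a + 'a \<Rightarrow> real"
    unfolding UN by (subst sum.union_disjoint) (auto simp: sum.reindex)
  show ?thesis
    by (simp add: inner_vec_def matrix_vector_mult_def symplectic_J_def block_matrix_def split mat_def
      if_distrib[of "\<lambda>c. c * _"] sum.delta' sum.delta sum_negf cong: if_cong)
      (simp add: mult.commute)
qed

text \<open>Linearity pulls J out of the sum. What remains is the gradient of the Hamiltonian once
  the tensors are supersymmetric.\<close>

lemma hamiltonian_field_eq:
  "hamiltonian_field k B x = symplectic_J *v (\<Sum>j = 2..k. real j *\<^sub>R tensor_apply j (B j) x)"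
  unfolding hamiltonian_field_def tensor_apply_matrix_tensor_mult
  by (simp add: linear_sum[OF matrix_vector_mul_linear] matrix_vector_mult_scaleR)

section \<open>Lipschitz bounds on balls\<close>

lemma abs_prod_list_nth_le:
  fixes x :: "real ^ 'n::finite"
  assumes "norm x \<le> r"
  shows "\<bar>\<Prod>l\<leftarrow>is. x $ l\<bar> \<le> r ^ length is"
proof (induction "is")
  case (Cons i js)
  have "\<bar>x $ i\<bar> \<le> r" using component_le_norm_cart[of x i] assms by simp
  with Cons show ?case by (auto simp: abs_mult intro!: mult_mono)
qed simp

lemma lipschitz_on_sum:
  fixes f :: "'i \<Rightarrow> 'a::metric_space \<Rightarrow> 'b::real_normed_vector"
  assumes "finite I" "\<And>i. i \<in> I \<Longrightarrow> \<exists>L. L-lipschitz_on S (f i)"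
  shows "\<exists>L. L-lipschitz_on S (\<lambda>x. \<Sum>i\<in>I. f i x)"
  using assms
proof (induction I rule: finite_induct)
  case empty
  have "0-lipschitz_on S (\<lambda>x. 0 :: 'b)" by (rule lipschitz_onI) auto
  then show ?case by auto
next
  case (insert i I)
  then obtain L M where "L-lipschitz_on S (f i)" "M-lipschitz_on S (\<lambda>x. \<Sum>i\<in>I. f i x)"
    by (metis insertI1 insertI2)
  from lipschitz_on_add[OF this] insert show ?case by auto
qed

lemma lipschitz_on_prod_list_nth:
  "\<exists>L. L-lipschitz_on (cball 0 r) (\<lambda>x :: real ^ 'n::finite. \<Prod>l\<leftarrow>is. x $ l)"
proof (induction "is")
  case Nil
  have "0-lipschitz_on (cball 0 r) (\<lambda>x :: real ^ 'n. 1 :: real)" by (rule lipschitz_onI) auto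
  then show ?case by auto
next
  case (Cons i js)
  let ?P = "\<lambda>x :: real ^ 'n. \<Prod>l\<leftarrow>js. x $ l"
  from Cons obtain L where L: "L-lipschitz_on (cball 0 r) ?P" by blast
  have L0: "L \<ge> 0" by (rule lipschitz_on_nonneg[OF L])
  \<comment> \<open>The constant comes from the product rule for differences. The absolute value
    keeps it nonnegative when \<open>r < 0\<close>, where the ball is empty.\<close>
  have "(\<bar>r\<bar> * L + \<bar>r\<bar> ^ length js)-lipschitz_on (cball 0 r) (\<lambda>x :: real ^ 'n. x $ i * ?P x)"
  proof (rule lipschitz_onI)
    fix x y :: "real ^ 'n" assume xy: "x \<in> cball 0 r" "y \<in> cball 0 r"
    have "x $ i * ?P x - y $ i * ?P y = x $ i * (?P x - ?P y) + (x - y) $ i * ?P y"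
      by (simp add: algebra_simps)
    also have "\<bar>\<dots>\<bar> \<le> \<bar>x $ i\<bar> * \<bar>?P x - ?P y\<bar> + \<bar>(x - y) $ i\<bar> * \<bar>?P y\<bar>"
      by (metis abs_mult abs_triangle_ineq)
    also have "\<dots> \<le> \<bar>r\<bar> * (L * norm (x - y)) + norm (x - y) * \<bar>r\<bar> ^ length js"
    proof (intro add_mono mult_mono component_le_norm_cart abs_prod_list_nth_le)
      show "\<bar>x $ i\<bar> \<le> \<bar>r\<bar>" using component_le_norm_cart[of x i] xy by simp
      show "\<bar>?P x - ?P y\<bar> \<le> L * norm (x - y)"
        using lipschitz_onD[OF L xy] by (simp add: dist_norm)
    qed (use xy L0 in auto)
    finally show "dist (x $ i * ?P x) (y $ i * ?P y) \<le> (\<bar>r\<bar> * L + \<bar>r\<bar> ^ length js) * dist x y"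
      by (simp add: dist_norm algebra_simps)
  qed (use L0 in auto)
  then show ?case by auto
qed

lemma lipschitz_on_tensor_apply:
  fixes A :: "'n::finite tensor"
  shows "\<exists>L. L-lipschitz_on (cball 0 r) (tensor_apply j A)"
proof -
  \<comment> \<open>The vector is a finite sum of scalar monomials times fixed vectors, which
    reduces the claim to monomials.\<close>
  have eq: "tensor_apply j A =
      (\<lambda>x. \<Sum>i\<in>UNIV. \<Sum>is | length is = j - 1. (\<Prod>l\<leftarrow>is. x $ l) *\<^sub>R (A (i # is) *\<^sub>R axis i 1))"
    by (simp add: fun_eq_iff vec_eq_iff tensor_apply_def axis_def if_distrib mult_ac cong: if_cong)
      (subst sum.swap, simp)
  have *: "\<exists>L. L-lipschitz_on (cball 0 r) (\<lambda>x :: real ^ 'n. (\<Prod>l\<leftarrow>is. x $ l) *\<^sub>R c)"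
    for "is" :: "'n list" and c :: "real ^ 'n"
  proof -
    obtain L where L: "L-lipschitz_on (cball 0 r) (\<lambda>x :: real ^ 'n. \<Prod>l\<leftarrow>is. x $ l)"
      using lipschitz_on_prod_list_nth by blast
    have "(L * norm c)-lipschitz_on (cball 0 r) (\<lambda>x :: real ^ 'n. (\<Prod>l\<leftarrow>is. x $ l) *\<^sub>R c)"
    proof (rule lipschitz_onI)
      fix x y :: "real ^ 'n" assume "x \<in> cball 0 r" "y \<in> cball 0 r"
      from mult_right_mono[OF lipschitz_onD[OF L this] norm_ge_zero[of c]]
      show "dist ((\<Prod>l\<leftarrow>is. x $ l) *\<^sub>R c) ((\<Prod>l\<leftarrow>is. y $ l) *\<^sub>R c) \<le> L * norm c * dist x y"
        by (simp add: dist_norm mult_ac flip: scaleR_left_diff_distrib)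
    qed (use lipschitz_on_nonneg[OF L] in auto)
    then show ?thesis by blast
  qed
  show ?thesis unfolding eq
  proof (rule lipschitz_on_sum[OF finite])
    fix i :: 'n
    show "\<exists>L. L-lipschitz_on (cball 0 r)
        (\<lambda>x :: real ^ 'n. \<Sum>is | length is = j - 1.
          (\<Prod>l\<leftarrow>is. x $ l) *\<^sub>R (A (i # is) *\<^sub>R (axis i 1 :: real ^ 'n)))"
      by (rule lipschitz_on_sum[OF finite_index_lists]) (rule *)
  qed
qed

lemma lipschitz_on_hamiltonian_field: "\<exists>L. L-lipschitz_on (cball 0 r) (hamiltonian_field k B)"
  unfolding hamiltonian_field_def
proof (intro lipschitz_on_sum)
  fix j
  obtain L where "L-lipschitz_on (cball 0 r) (tensor_apply j (matrix_tensor_mult symplectic_J (B j)))"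
    using lipschitz_on_tensor_apply by blast
  from lipschitz_on_cmult[OF this]
  show "\<exists>L. L-lipschitz_on (cball 0 r)
      (\<lambda>x. real j *\<^sub>R tensor_apply j (matrix_tensor_mult symplectic_J (B j)) x)" by blast
qed simp

section \<open>The Hamiltonian near the origin\<close>

text \<open>A cubic bound common to all orders from 3 on lets the whole remainder be compared with
  the quadratic part at once.\<close>

lemma abs_tensor_form_le:
  fixes x :: "real ^ 'n::finite"
  assumes "norm x \<le> 1" "3 \<le> j"
  shows "\<bar>tensor_form j A x\<bar> \<le> (\<Sum>is | length is = j. \<bar>A is\<bar>) * norm x ^ 3"
proof -
  have "\<bar>tensor_form j A x\<bar> \<le> (\<Sum>is | length is = j. \<bar>A is * (\<Prod>l\<leftarrow>is. x $ l)\<bar>)"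
    unfolding tensor_form_def by (rule sum_abs)
  also have "\<dots> \<le> (\<Sum>is | length is = j. \<bar>A is\<bar> * norm x ^ 3)"
  proof (intro sum_mono)
    fix "is" :: "'n list" assume "is \<in> {is. length is = j}"
    then have "\<bar>\<Prod>l\<leftarrow>is. x $ l\<bar> \<le> norm x ^ j" using abs_prod_list_nth_le[of x "norm x" "is"] by simp
    also have "\<dots> \<le> norm x ^ 3" using assms by (intro power_decreasing) auto
    finally show "\<bar>A is * (\<Prod>l\<leftarrow>is. x $ l)\<bar> \<le> \<bar>A is\<bar> * norm x ^ 3"
      by (simp add: abs_mult mult_left_mono)
  qed
  finally show ?thesis by (simp add: sum_distrib_right)
qed

text \<open>The constant is the minimum of the quadratic form on the compact unit sphere;
  homogeneity of degree 2 carries the bound to all vectors.\<close>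

lemma positive_definite_lower_bound:
  fixes M :: "real ^ 'n ^ 'n::finite"
  assumes "positive_definite M"
  obtains c where "c > 0" "\<And>x. c * norm x ^ 2 \<le> x \<bullet> (M *v x)"
proof -
  have "sphere (0 :: real ^ 'n) 1 \<noteq> {}" by simp
  moreover have "continuous_on (sphere 0 1) (\<lambda>x. x \<bullet> (M *v x))"
    by (intro continuous_intros linear_continuous_on) simp
  ultimately obtain z where z: "z \<in> sphere 0 1"
    and zmin: "\<And>x. x \<in> sphere 0 1 \<Longrightarrow> z \<bullet> (M *v z) \<le> x \<bullet> (M *v x)"
    using continuous_attains_inf[OF compact_sphere] by blast
  show thesis
  proof
    have "z \<noteq> 0" using z by auto
    then show "z \<bullet> (M *v z) > 0" using assms by (simp add: positive_definite_def)
  next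
    fix x :: "real ^ 'n"
    show "z \<bullet> (M *v z) * norm x ^ 2 \<le> x \<bullet> (M *v x)"
    proof (cases "x = 0")
      case False
      have "z \<bullet> (M *v z) \<le> sgn x \<bullet> (M *v sgn x)"
        using False by (intro zmin) (simp add: norm_sgn)
      also have "\<dots> = (x \<bullet> (M *v x)) / norm x ^ 2"
        by (simp add: sgn_div_norm matrix_vector_mult_scaleR power2_eq_square field_simps)
      finally show ?thesis using False by (simp add: field_simps)
    qed simp
  qed
qed

lemma tensor_form_2: "tensor_form 2 A x = x \<bullet> (tensor_matrix A *v x)"
proof -
  have "tensor_apply 2 A x = tensor_matrix A *v x"
    using sum_lists_length_Suc[of "\<lambda>is. A (i # is) * (\<Prod>l\<leftarrow>is. x $ l)" 0 for i]
    by (simp add: vec_eq_iff tensor_apply_def tensor_matrix_def matrix_vector_mult_def sum_lists_length_Suc)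
  then show ?thesis by (simp add: tensor_form_eq_inner)
qed

definition hamiltonian :: "nat \<Rightarrow> (nat \<Rightarrow> 'n tensor) \<Rightarrow> real ^ 'n::finite \<Rightarrow> real" where
  "hamiltonian k B x = (\<Sum>j = 2..k. tensor_form j (B j) x)"

lemma hamiltonian_0: "hamiltonian k B 0 = 0"
  unfolding hamiltonian_def by (simp add: tensor_form_eq_inner)

text \<open>The sign \<open>\<sigma>\<close> treats the positive and the negative definite case
  together. Near 0 the quadratic part dominates the terms of order at least 3.\<close>

lemma hamiltonian_strict_min:
  fixes B :: "nat \<Rightarrow> 'n::finite tensor"
  assumes k: "k \<ge> 2" and \<sigma>: "\<bar>\<sigma>\<bar> = 1"
    and c: "c > 0" "\<And>x. c * norm x ^ 2 \<le> \<sigma> * (x \<bullet> (tensor_matrix (B 2) *v x))"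
  obtains \<rho> where "\<rho> > 0" "\<And>x. x \<noteq> 0 \<Longrightarrow> norm x \<le> \<rho> \<Longrightarrow> 0 < \<sigma> * hamiltonian k B x"
proof
  define C where "C = (\<Sum>j = 3..k. \<Sum>is :: 'n list | length is = j. \<bar>B j is\<bar>)"
  have C: "C \<ge> 0" unfolding C_def by (intro sum_nonneg) auto
  \<comment> \<open>Radius at most 1 permits the cubic bound, and
    \<open>(C + 1) * norm x \<le> c\<close> gives \<open>C * norm x < c\<close> for
    \<open>x \<noteq> 0\<close>. Using \<open>C + 1\<close> also avoids dividing by zero, as
    \<open>C = 0\<close> when \<open>k = 2\<close>.\<close>
  let ?\<rho> = "min 1 (c / (C + 1))"
  show "?\<rho> > 0" using c C by simp
  fix x :: "real ^ 'n" assume x: "x \<noteq> 0" "norm x \<le> ?\<rho>"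
  define R where "R = (\<Sum>j = 3..k. tensor_form j (B j) x)"
  have split: "hamiltonian k B x = tensor_form 2 (B 2) x + R"
    unfolding hamiltonian_def R_def using k by (simp add: sum.atLeast_Suc_atMost eval_nat_numeral)
  have "\<bar>R\<bar> \<le> (\<Sum>j = 3..k. \<bar>tensor_form j (B j) x\<bar>)"
    unfolding R_def by (rule sum_abs)
  also have "\<dots> \<le> C * norm x ^ 3"
    unfolding C_def sum_distrib_right[of _ "{3..k}"] using x
    by (intro sum_mono abs_tensor_form_le) auto
  also have "\<dots> = C * norm x * norm x ^ 2" by (simp add: eval_nat_numeral)
  also have "\<dots> < c * norm x ^ 2"
  proof (rule mult_strict_right_mono)
    have "(C + 1) * norm x \<le> c" using x C by (simp add: pos_le_divide_eq mult.commute)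
    then show "C * norm x < c" using x by (simp add: algebra_simps) (smt (verit) zero_less_norm_iff)
  qed (use x in simp)
  also have "\<dots> \<le> \<sigma> * tensor_form 2 (B 2) x" using c by (simp add: tensor_form_2)
  finally have "\<bar>\<sigma> * R\<bar> < \<sigma> * tensor_form 2 (B 2) x" using \<sigma> by (simp add: abs_mult)
  then show "0 < \<sigma> * hamiltonian k B x" unfolding split by (simp add: algebra_simps)
qed

section \<open>Stability of the origin\<close>

theorem theorem3:
  fixes k :: nat
    and B :: "nat \<Rightarrow> ('m::finite + 'm) tensor"
  assumes "k \<ge> 2"
    and "\<And>j. j \<in> {2..k} \<Longrightarrow> supersymmetric j (B j)"
    and "positive_definite (tensor_matrix (B 2)) \<or> negative_definite (tensor_matrix (B 2))"
  shows "equilibrium (hamiltonian_field k B) 0 \<and> lyapunov_stable (hamiltonian_field k B) 0"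
proof
  have "tensor_apply j (B j) 0 = 0" if "j \<in> {2..k}" for j
  proof -
    \<comment> \<open>Since \<open>j \<ge> 2\<close>, the list is nonempty and the product has a
      zero factor.\<close>
    have "(\<Prod>l\<leftarrow>is. (0 :: real ^ ('m + 'm)) $ l) = 0" if "length is = j - 1" for "is"
      using that \<open>j \<in> {2..k}\<close> by (cases "is") auto
    then show ?thesis by (simp add: tensor_apply_def vec_eq_iff)
  qed
  then show "equilibrium (hamiltonian_field k B) 0"
    by (simp add: equilibrium_def hamiltonian_field_eq)
next
  \<comment> \<open>\<open>\<sigma>\<close> is 1 or -1 according to the sign of the definite matrix,
    so \<open>\<sigma>\<close> times the Hamiltonian is the function with a strict minimum at
    0.\<close>
  obtain \<sigma> c :: real where \<sigma>: "\<bar>\<sigma>\<bar> = 1" and c: "c > 0"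
    "\<And>x. c * norm x ^ 2 \<le> \<sigma> * (x \<bullet> (tensor_matrix (B 2) *v x))"
    using assms(3)
  proof
    assume "positive_definite (tensor_matrix (B 2))"
    then show thesis
      using positive_definite_lower_bound that[of 1] by (metis abs_one mult_1)
  next
    assume "negative_definite (tensor_matrix (B 2))"
    have minus: "- tensor_matrix (B 2) *v x = - (tensor_matrix (B 2) *v x)" for x
      by (simp add: matrix_vector_mult_def vec_eq_iff sum_negf)
    with \<open>negative_definite (tensor_matrix (B 2))\<close> have "positive_definite (- tensor_matrix (B 2))"
      by (simp add: positive_definite_def negative_definite_def)
    then obtain c where "c > 0" "\<And>x. c * norm x ^ 2 \<le> x \<bullet> (- tensor_matrix (B 2) *v x)"
      using positive_definite_lower_bound by blast
    then show thesis by (intro that[of "-1" c]) (auto simp: minus)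
  qed
  obtain \<rho> where \<rho>: "\<rho> > 0" "\<And>x. x \<noteq> 0 \<Longrightarrow> norm x \<le> \<rho> \<Longrightarrow> 0 < \<sigma> * hamiltonian k B x"
    using hamiltonian_strict_min[of k \<sigma> c B] assms(1) \<sigma> c by blast
  let ?G = "\<lambda>x. \<Sum>j = 2..k. real j *\<^sub>R tensor_apply j (B j) x"
  show "lyapunov_stable (hamiltonian_field k B) 0"
  proof (rule lyapunov_stable_if_conserved_strict_min)
    fix y
    have "(hamiltonian k B has_derivative (\<lambda>v. \<Sum>j = 2..k. real j * (v \<bullet> tensor_apply j (B j) y))) (at y)"
      unfolding hamiltonian_def[abs_def] using assms(2)
      by (intro has_derivative_sum tensor_form_has_derivative) auto
    also have "(\<lambda>v. \<Sum>j = 2..k. real j * (v \<bullet> tensor_apply j (B j) y)) = (\<lambda>v. v \<bullet> ?G y)"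
      by (simp add: inner_sum_right)
    finally show "((\<lambda>y. \<sigma> * hamiltonian k B y) has_derivative (\<lambda>v. \<sigma> * (v \<bullet> ?G y))) (at y)"
      by (rule has_derivative_mult_right)
    \<comment> \<open>The field is J applied to the gradient \<open>?G y\<close>, hence orthogonal
      to it.\<close>
    show "\<sigma> * (hamiltonian_field k B y \<bullet> ?G y) = 0"
      using inner_symplectic_J_self[of "?G y"] by (simp add: hamiltonian_field_eq inner_commute)
  qed (use \<rho> in \<open>auto simp: hamiltonian_0 lipschitz_on_hamiltonian_field\<close>)
qed

end
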